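(* Let $n\in\mathbb{N}$ and let $V$ be a vector space of dimension $2^n$ over a field $\mathbb{K}$ equipped with a $\mathbb{K}$-bilinear operation $*:V\times V\to V$. Suppose $V$ has a basis $\{\mathrm e_k\}_{k=0}^{2^n-1}$ and a function $s:\{0,\dots,2^n-1\}^2\to\mathbb{K}$ such that $\mathrm e_p*\mathrm e_q=s(p,q)\,\mathrm e_{p\oplus q}$ for all $p,q$. Suppose also that $V$ has a diagonal basis $\{\tilde e_\alpha\}_{\alpha=0}^{2^n-1}$, and let $T$ be the change-of-coordinates matrix defined by $\mathrm e_k=\sum_{\alpha=0}^{2^n-1}T_{\alpha,k}\,\tilde e_\alpha$ for $k=0,\dots,2^n-1$. Then for all $\alpha,p,q\in\{0,\dots,2^n-1\}$: 1. $T_{\alpha,0}=s(0,0)$; 2. $T_{\alpha,p}^2=s(p,p)\,s(0,0)$; 3. $s(p,q)=s(q,p)$; 4. $s(p,p)\neq 0$; 5. $s(p,0)=s(0,q)=s(0,0)$; 6. $s(p,p)\,s(0,0)$ has a square root, with at least two distinct solutions in $\mathbb{K}$.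
   Context: Diagonal basis: a basis $\{\tilde e_\alpha\}_{\alpha=0}^{m-1}$ of an $m$-dimensional algebra $(V,* )$ is diagonal (or canonical) if $\tilde e_\alpha*\tilde e_\beta=\delta_{\alpha,\beta}\,\tilde e_\alpha$ for all $\alpha,\beta$, where $\delta$ is the Kronecker delta. No condition other than bilinearity is imposed on $*$, and no restriction is placed on the function $s$ beyond the displayed ones. $p\oplus q$ denotes bitwise XOR of nonnegative integers (addition modulo 2 of the binary digits, position by position). $\mathbb{N}$ includes $0$.
   Formalization: In item 6, "at least two distinct solutions" is claimed only when n ≥ 1 or K has characteristic different from 2; for n = 0 in characteristic 2 (e.g. K = V = F_2) it is false, and there only the existence of a square root is claimed. *)

theory Defs
  imports Complex_Main
begin

unbundle bit_operations_syntax

text \<open>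
  The family \<open>b 0, \<dots>, b (m - 1)\<close> is a basis of the whole space; values of \<open>b\<close>
  outside \<open>{..<m}\<close> are irrelevant. Injectivity is needed because linear independence and
  span are notions about the set of vectors, not about the indexing.
\<close>
definition basis_family :: "('k::field \<Rightarrow> 'v::ab_group_add \<Rightarrow> 'v) \<Rightarrow> nat \<Rightarrow> (nat \<Rightarrow> 'v) \<Rightarrow> bool"
  where "basis_family scale m b \<longleftrightarrow>
    inj_on b {..<m} \<and>
    \<not> module.dependent scale (b ` {..<m}) \<and>
    module.span scale (b ` {..<m}) = UNIV"

definition bilinear_op :: "('k::field \<Rightarrow> 'v::ab_group_add \<Rightarrow> 'v) \<Rightarrow> ('v \<Rightarrow> 'v \<Rightarrow> 'v) \<Rightarrow> bool"
  where "bilinear_op scale mult \<longleftrightarrow>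
    (\<forall>x. Vector_Spaces.linear scale scale (\<lambda>y. mult x y)) \<and>
    (\<forall>y. Vector_Spaces.linear scale scale (\<lambda>x. mult x y))"

definition diagonal_basis ::
    "('k::field \<Rightarrow> 'v::ab_group_add \<Rightarrow> 'v) \<Rightarrow> ('v \<Rightarrow> 'v \<Rightarrow> 'v) \<Rightarrow> nat \<Rightarrow> (nat \<Rightarrow> 'v) \<Rightarrow> bool"
  where "diagonal_basis scale mult m b \<longleftrightarrow>
    basis_family scale m b \<and>
    (\<forall>\<alpha><m. \<forall>\<beta><m. mult (b \<alpha>) (b \<beta>) = scale (if \<alpha> = \<beta> then 1 else 0) (b \<alpha>))"

end

theory Submission
  imports Defs
begin

text \<open>
  The product \<open>e p * e' \<alpha> = T \<alpha> p e' \<alpha>\<close> shows that each row of \<open>T\<close> satisfies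
  \<open>T \<alpha> p * T \<alpha> q = s p q * T \<alpha> (p XOR q)\<close>. Every row and every column of \<open>T\<close> is nonzero,
  so the cases \<open>q = p\<close> and \<open>q = 0\<close> give all the identities. Two distinct square roots are
  \<open>T \<alpha> p\<close> and its negative, unless the characteristic is 2. In that case square roots are
  unique, so the columns of \<open>T\<close> are constant; for \<open>n > 0\<close> this makes \<open>e 0\<close> and \<open>e 1\<close>
  proportional, a contradiction.
\<close>

lemma basis_family_nonzero:
  assumes "vector_space scale" "basis_family scale m b" "i < m"
  shows "b i \<noteq> 0"
proof -
  interpret vector_space scale by fact
  show ?thesis
    using assms(2,3) dependent_zero[of "b ` {..<m}"] unfolding basis_family_def
    by (metis image_eqI lessThan_iff)
qed

text \<open>Dividing by \<open>c\<close> would place \<open>b i\<close> in the span of the other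
  basis vectors.\<close>

lemma basis_family_not_proportional:
  assumes "vector_space scale" "basis_family scale m b" "i < m" "j < m" "i \<noteq> j" "c \<noteq> 0"
  shows "scale c (b i) \<noteq> scale d (b j)"
proof
  interpret vector_space scale by fact
  assume eq: "scale c (b i) = scale d (b j)"
  \<comment> \<open>Injectivity keeps \<open>b j\<close> in the set once \<open>b i\<close> is
    removed.\<close>
  have "b i \<noteq> b j"
    using assms(2-5) unfolding basis_family_def by (auto dest: inj_onD)
  then have "scale (d / c) (b j) \<in> span (b ` {..<m} - {b i})"
    using assms(4) by (intro span_scale span_base) auto
  moreover have "b i = scale (d / c) (b j)"
    using arg_cong[OF eq, of "scale (inverse c)"] assms(6) by (simp add: field_simps)
  ultimately have "b i \<in> span (b ` {..<m} - {b i})"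
    by simp
  then show False
    using assms(2,3) unfolding basis_family_def dependent_def by blast
qed

text \<open>The guard on the last claim excludes only \<open>n = 0\<close> in characteristic 2,
  where square roots are unique and so two distinct ones cannot exist.\<close>

theorem theorem13:
  fixes n :: nat
    and scale :: "'k::field \<Rightarrow> 'v::ab_group_add \<Rightarrow> 'v"
    and mult :: "'v \<Rightarrow> 'v \<Rightarrow> 'v"
    and e e' :: "nat \<Rightarrow> 'v"
    and s T :: "nat \<Rightarrow> nat \<Rightarrow> 'k"
  assumes V: "vector_space scale"
    and dim: "vector_space.dim scale UNIV = 2 ^ n"
    and bilinear: "bilinear_op scale mult"
    and basis: "basis_family scale (2 ^ n) e"
    and mult_basis: "\<And>p q. p < 2 ^ n \<Longrightarrow> q < 2 ^ n \<Longrightarrow>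
          mult (e p) (e q) = scale (s p q) (e (p XOR q))"
    and diagonal: "diagonal_basis scale mult (2 ^ n) e'"
    and change: "\<And>k. k < 2 ^ n \<Longrightarrow> e k = (\<Sum>\<alpha><2 ^ n. scale (T \<alpha> k) (e' \<alpha>))"
  shows "\<forall>\<alpha><2 ^ n. \<forall>p<2 ^ n. \<forall>q<2 ^ n.
      T \<alpha> 0 = s 0 0 \<and>
      (T \<alpha> p)\<^sup>2 = s p p * s 0 0 \<and>
      s p q = s q p \<and>
      s p p \<noteq> 0 \<and>
      (s p 0 = s 0 q \<and> s 0 q = s 0 0) \<and>
      ((\<exists>x. x\<^sup>2 = s p p * s 0 0) \<and>
       (n \<noteq> 0 \<or> (2::'k) \<noteq> 0 \<longrightarrow>
         (\<exists>x y. x \<noteq> y \<and> x\<^sup>2 = s p p * s 0 0 \<and> y\<^sup>2 = s p p * s 0 0)))"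
proof -
  let ?N = "2 ^ n :: nat"
  interpret vector_space scale by (fact V)
  have hom_right: "module_hom scale scale (mult x)" and hom_left: "module_hom scale scale (\<lambda>x. mult x y)" for x y
    using bilinear unfolding bilinear_op_def by (auto simp: Vector_Spaces.linear_def)
  have basis': "basis_family scale ?N e'"
    and mult_e': "\<And>\<alpha> \<beta>. \<alpha> < ?N \<Longrightarrow> \<beta> < ?N \<Longrightarrow> mult (e' \<alpha>) (e' \<beta>) = scale (if \<alpha> = \<beta> then 1 else 0) (e' \<alpha>)"
    using diagonal unfolding diagonal_basis_def by auto
  have e_nz: "e p \<noteq> 0" and e'_nz: "e' p \<noteq> 0" if "p < ?N" for p
    using basis_family_nonzero[OF V basis that] basis_family_nonzero[OF V basis' that] by auto
  \<comment> \<open>Truncation to \<open>n\<close> bits commutes with XOR and fixes exactly the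
    numbers below \<open>2 ^ n\<close>.\<close>
  have xor_less: "p XOR q < ?N" if "p < ?N" "q < ?N" for p q
    using that by (metis of_nat_xor_eq take_bit_nat_eq_self_iff take_bit_xor)
  \<comment> \<open>Multiplying by \<open>e' \<alpha>\<close> extracts the coordinate at \<alpha>.
    Commutativity is not assumed, so each side is treated separately.\<close>
  have coord_right: "mult (\<Sum>\<beta><?N. scale (f \<beta>) (e' \<beta>)) (e' \<alpha>) = scale (f \<alpha>) (e' \<alpha>)" if "\<alpha> < ?N" for f \<alpha>
  proof -
    have "mult (\<Sum>\<beta><?N. scale (f \<beta>) (e' \<beta>)) (e' \<alpha>) = (\<Sum>\<beta><?N. scale (f \<beta>) (mult (e' \<beta>) (e' \<alpha>)))"
      by (simp add: module_hom.sum[OF hom_left] module_hom.scale[OF hom_left])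
    also have "\<dots> = (\<Sum>\<beta><?N. if \<beta> = \<alpha> then scale (f \<alpha>) (e' \<alpha>) else 0)"
      using that by (intro sum.cong) (auto simp: mult_e')
    finally show ?thesis using that by simp
  qed
  have coord_left: "mult (e' \<alpha>) (\<Sum>\<beta><?N. scale (f \<beta>) (e' \<beta>)) = scale (f \<alpha>) (e' \<alpha>)" if "\<alpha> < ?N" for f \<alpha>
  proof -
    have "mult (e' \<alpha>) (\<Sum>\<beta><?N. scale (f \<beta>) (e' \<beta>)) = (\<Sum>\<beta><?N. scale (f \<beta>) (mult (e' \<alpha>) (e' \<beta>)))"
      by (simp add: module_hom.sum[OF hom_right] module_hom.scale[OF hom_right])
    also have "\<dots> = (\<Sum>\<beta><?N. if \<beta> = \<alpha> then scale (f \<alpha>) (e' \<alpha>) else 0)"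
      using that by (intro sum.cong) (auto simp: mult_e')
    finally show ?thesis using that by simp
  qed
  have e_e': "mult (e p) (e' \<alpha>) = scale (T \<alpha> p) (e' \<alpha>)" if "p < ?N" "\<alpha> < ?N" for p \<alpha>
    using coord_right[OF that(2)] change[OF that(1)] by simp
  have e_e: "mult (e p) (e q) = (\<Sum>\<alpha><?N. scale (T \<alpha> p * T \<alpha> q) (e' \<alpha>))" if "p < ?N" "q < ?N" for p q
  proof -
    have "mult (e p) (e q) = (\<Sum>\<alpha><?N. scale (T \<alpha> p) (mult (e' \<alpha>) (e q)))"
      unfolding change[OF that(1)]
      by (simp add: module_hom.sum[OF hom_left] module_hom.scale[OF hom_left])
    also have "\<dots> = (\<Sum>\<alpha><?N. scale (T \<alpha> p * T \<alpha> q) (e' \<alpha>))"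
      unfolding change[OF that(2)] by (intro sum.cong) (auto simp: coord_left)
    finally show ?thesis .
  qed
  have T_mult: "T \<alpha> p * T \<alpha> q = s p q * T \<alpha> (p XOR q)" if "\<alpha> < ?N" "p < ?N" "q < ?N" for \<alpha> p q
  proof -
    \<comment> \<open>Compute \<open>(e p * e q) * e' \<alpha>\<close> twice: the inner product is
      componentwise in the diagonal basis, and it is also a multiple of
      \<open>e (p XOR q)\<close>.\<close>
    have "scale (T \<alpha> p * T \<alpha> q) (e' \<alpha>) = mult (mult (e p) (e q)) (e' \<alpha>)"
      using that by (simp add: e_e coord_right)
    also have "\<dots> = scale (s p q) (mult (e (p XOR q)) (e' \<alpha>))"
      using that by (simp add: mult_basis module_hom.scale[OF hom_left])
    also have "\<dots> = scale (s p q * T \<alpha> (p XOR q)) (e' \<alpha>)"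
      using that by (simp add: e_e' xor_less)
    finally show ?thesis using e'_nz[OF that(1)] by simp
  qed
  have sym: "s p q = s q p" if "p < ?N" "q < ?N" for p q
  proof -
    \<comment> \<open>Componentwise multiplication is commutative; the coefficients of the nonzero
      vector \<open>e (p XOR q)\<close> can then be compared.\<close>
    have "mult (e p) (e q) = mult (e q) (e p)"
      using that by (simp add: e_e mult.commute)
    then show ?thesis
      using that by (simp add: mult_basis e_nz xor_less xor.commute[of q p])
  qed
  have column: "\<exists>\<alpha><?N. T \<alpha> p \<noteq> 0" if "p < ?N" for p
    using change[OF that] e_nz[OF that] by (metis (no_types, lifting) lessThan_iff scale_zero_left sum.neutral)
  \<comment> \<open>If a row vanished, right multiplication by \<open>e' \<alpha>\<close> would kill
    every \<open>e p\<close>, hence all of the space, including the nonzero idempotent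
    \<open>e' \<alpha>\<close> itself.\<close>
  have row: "\<exists>p<?N. T \<alpha> p \<noteq> 0" if "\<alpha> < ?N" for \<alpha>
  proof (rule ccontr)
    assume "\<not> ?thesis"
    then have "mult x (e' \<alpha>) = 0" if "x \<in> e ` {..<?N}" for x
      using that \<open>\<alpha> < ?N\<close> by (auto simp: e_e')
    moreover have "e' \<alpha> \<in> span (e ` {..<?N})"
      using basis unfolding basis_family_def by auto
    ultimately have "mult (e' \<alpha>) (e' \<alpha>) = 0"
      using module_hom.eq_0_on_span[OF hom_left] by blast
    then show False using that by (simp add: mult_e' e'_nz)
  qed
  have T0: "T \<alpha> 0 = s 0 0" and T0_nz: "T \<alpha> 0 \<noteq> 0" if "\<alpha> < ?N" for \<alpha>
  proof -
    obtain p where "p < ?N" "T \<alpha> p \<noteq> 0" using row \<open>\<alpha> < ?N\<close> by blast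
    \<comment> \<open>Since \<open>p XOR p = 0\<close>, the nonzero square of
      \<open>T \<alpha> p\<close> is a multiple of \<open>T \<alpha> 0\<close>. Taking
      \<open>p = q = 0\<close> next lets one factor \<open>T \<alpha> 0\<close> cancel.\<close>
    then show "T \<alpha> 0 \<noteq> 0" using T_mult[of \<alpha> p p] \<open>\<alpha> < ?N\<close> by auto
    then show "T \<alpha> 0 = s 0 0" using T_mult[of \<alpha> 0 0] \<open>\<alpha> < ?N\<close> by simp
  qed
  have s00: "s 0 0 \<noteq> 0" using T0[of 0] T0_nz[of 0] by simp
  have T_square: "(T \<alpha> p)\<^sup>2 = s p p * s 0 0" if "\<alpha> < ?N" "p < ?N" for \<alpha> p
    using T_mult[of \<alpha> p p] T0 that by (simp add: power2_eq_square)
  have s_diag: "s p p \<noteq> 0" if "p < ?N" for p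
    using column[OF that] T_square[OF _ that] by auto
  have s_zero: "s p 0 = s 0 0" if p: "p < ?N" for p
  proof -
    obtain \<alpha> where "\<alpha> < ?N" "T \<alpha> p \<noteq> 0" using column[OF p] by blast
    then show ?thesis using T_mult[of \<alpha> p 0] T0[of \<alpha>] p by simp
  qed
  have two: "(2::'k) \<noteq> 0" if "n \<noteq> 0"
  proof
    assume "(2::'k) = 0"
    \<comment> \<open>Only for \<open>n > 0\<close> is there a second basis vector to compare with
      \<open>e 0\<close>.\<close>
    have one: "1 < ?N" using that by (intro one_less_power) auto
    have const: "T \<alpha> 1 = T 0 1" if "\<alpha> < ?N" for \<alpha>
    proof -
      have "(T \<alpha> 1)\<^sup>2 = (T 0 1)\<^sup>2" using T_square[OF _ one] that by simp
      moreover have "- T 0 1 = T 0 1"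
        using \<open>(2::'k) = 0\<close> by (metis mult_2 mult_zero_left neg_eq_iff_add_eq_0)
      ultimately show ?thesis by (metis power2_eq_iff)
    qed
    \<comment> \<open>Columns 0 and 1 are constant with values \<open>s 0 0\<close> and
      \<open>T 0 1\<close>; cross-multiplying by these values makes them agree.\<close>
    have "scale (s 0 0) (e 1) = (\<Sum>\<alpha><?N. scale (s 0 0 * T \<alpha> 1) (e' \<alpha>))"
      by (simp only: change[OF one] scale_sum_right scale_scale)
    also have "\<dots> = (\<Sum>\<alpha><?N. scale (T 0 1 * T \<alpha> 0) (e' \<alpha>))"
    proof (rule sum.cong[OF refl])
      fix \<alpha> assume "\<alpha> \<in> {..<?N}"
      then show "scale (s 0 0 * T \<alpha> 1) (e' \<alpha>) = scale (T 0 1 * T \<alpha> 0) (e' \<alpha>)"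
        by (metis T0 const lessThan_iff mult.commute)
    qed
    also have "\<dots> = scale (T 0 1) (e 0)"
      by (simp add: change[of 0] scale_sum_right)
    finally have "scale (s 0 0) (e 1) = scale (T 0 1) (e 0)" .
    then show False
      using basis_family_not_proportional[OF V basis one, of 0] s00 by simp
  qed
  have two_roots: "\<exists>x y. x \<noteq> y \<and> x\<^sup>2 = s p p * s 0 0 \<and> y\<^sup>2 = s p p * s 0 0"
    if "(2::'k) \<noteq> 0" "p < ?N" for p
  proof (intro exI conjI)
    \<comment> \<open>The witnesses are \<open>T 0 p\<close> and its negative, which differ because
      \<open>2 * T 0 p\<close> is nonzero.\<close>
    have "T 0 p \<noteq> 0" using T_square[of 0 p] s_diag s00 that(2) by force
    then show "T 0 p \<noteq> - T 0 p"
      using that(1) by (metis eq_neg_iff_add_eq_0 mult_2 mult_eq_0_iff)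
  qed (use T_square[of 0 p] that in auto)
  have s_zero': "s 0 q = s 0 0" if "q < ?N" for q
    using sym[of 0 q] s_zero[OF that] that by simp
  have root: "\<exists>x. x\<^sup>2 = s p p * s 0 0" if "p < ?N" for p
    using T_square[of 0 p] that by auto
  show ?thesis
    by (intro allI impI conjI; metis T0 T_square sym s_diag s_zero s_zero' root two two_roots)
qed

end
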